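(* Let $h\in\mathbb{Z}$ with $3\nmid h$ be such that $p=h^2+3h+9$ is a prime number, and let $\eta_p^{(0)},\eta_p^{(1)},\eta_p^{(2)}$ be the cubic Gaussian periods of $p$. If $h\equiv1\pmod3$, then $$\left(\frac{h-1}{3}-\eta_p^{(0)}\right)^{\frac13}+\left(\frac{h-1}{3}-\eta_p^{(1)}\right)^{\frac13}+\left(\frac{h-1}{3}-\eta_p^{(2)}\right)^{\frac13}=\left(6+h-3p^{\frac13}\right)^{\frac13},$$ and if $h\equiv2\pmod3$, then $$\left(\frac{h+1}{3}+\eta_p^{(0)}\right)^{\frac13}+\left(\frac{h+1}{3}+\eta_p^{(1)}\right)^{\frac13}+\left(\frac{h+1}{3}+\eta_p^{(2)}\right)^{\frac13}=\left(6+h-3p^{\frac13}\right)^{\frac13}.$$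
   Context: For a prime $p\equiv1\pmod3$, let $C_0$ be the subgroup of $\mathbb{Z}_p^*=(\mathbb{Z}/p\mathbb{Z})^*$ consisting of the cubes (of order $\frac{p-1}{3}$), and let $C_1,C_2$ be the other two cosets of $C_0$ in $\mathbb{Z}_p^*$ (in any order). The cubic Gaussian periods are $\eta_p^{(k)}=\sum_{j\in C_k}e^{2\pi i j/p}$, $k=0,1,2$; they are real numbers. All cube roots $(\cdot)^{1/3}$ are real cube roots of real numbers. (If $3\nmid h$ then $h^2+3h+9\equiv1\pmod3$.) *)

theory Defs
  imports "HOL-Analysis.Analysis" "HOL-Number_Theory.Residues"
begin

text \<open>
  The residue classes modulo \<open>p\<close> are represented by the integers \<open>0, \<dots>, p - 1\<close>,
  as in \<open>residue_ring\<close>.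
\<close>

definition mult_residues :: "nat \<Rightarrow> int monoid" where
  "mult_residues p = units_of (residue_ring (int p))"

definition cubes :: "nat \<Rightarrow> int set" where
  "cubes p = (\<lambda>x. x [^]\<^bsub>mult_residues p\<^esub> (3::nat)) ` carrier (mult_residues p)"

text \<open>
  The family \<open>C 0, C 1, C 2\<close> enumerates the cosets of the subgroup of cubes, starting with
  the subgroup itself; the order of \<open>C 1\<close> and \<open>C 2\<close> is left open.
  Values of \<open>C\<close> at other indices are irrelevant.
\<close>

definition cubic_cosets :: "nat \<Rightarrow> (nat \<Rightarrow> int set) \<Rightarrow> bool" where
  "cubic_cosets p C \<longleftrightarrow>
     C 0 = cubes p \<and> bij_betw C {0, 1, 2} (rcosets\<^bsub>mult_residues p\<^esub> (cubes p))"

definition gaussian_period :: "nat \<Rightarrow> int set \<Rightarrow> complex" where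
  "gaussian_period p A = (\<Sum>j\<in>A. exp (2 * of_real pi * \<i> * of_int j / of_nat p))"

text \<open>
  The cubic Gaussian periods are real numbers, so passing to \<open>Re\<close> loses nothing.
\<close>

lemma gaussian_period_cubic_real:
  assumes p: "prime p" and A: "A \<in> rcosets\<^bsub>mult_residues p\<^esub> (cubes p)"
  shows "gaussian_period p A \<in> \<real>"
proof -
  interpret residues_prime p "residue_ring (int p)"
    using p by unfold_locales auto
  let ?G = "mult_residues p"
  have p1: "int p > 1" using prime_gt_1_nat[OF p] by simp
  have car: "carrier ?G = {1..int p - 1}"
    using p1 by (simp add: mult_residues_def units_of_carrier res_prime_units_eq of_nat_diff)
  have mul: "x \<otimes>\<^bsub>?G\<^esub> y = (x * y) mod int p" for x y
    by (simp add: mult_residues_def units_of_mult res_mult_eq)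
  have pow: "x [^]\<^bsub>?G\<^esub> (3::nat) = x ^ 3 mod int p" if "x \<in> carrier ?G" for x
  proof -
    have "\<one>\<^bsub>?G\<^esub> = 1" by (simp add: mult_residues_def units_of_one res_one_eq)
    thus ?thesis
      by (simp add: numeral_3_eq_3 mul mod_simps algebra_simps)
  qed
  from A obtain a where a: "a \<in> carrier ?G" and Aeq: "A = cubes p #>\<^bsub>?G\<^esub> a"
    by (auto simp: RCOSETS_def)
  have Aeq': "A = (\<lambda>x. (x ^ 3 mod int p * a) mod int p) ` {1..int p - 1}"
    unfolding Aeq r_coset_def cubes_def mul using pow by (auto simp: car)
  have neg: "int p - x \<in> A" if "x \<in> A" for x
  proof -
    from that obtain y where y: "y \<in> {1..int p - 1}" and x: "x = (y ^ 3 mod int p * a) mod int p"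
      unfolding Aeq' by blast
    have xn0: "x \<noteq> 0"
    proof
      assume "x = 0"
      hence "int p dvd y ^ 3 * a" using x by (simp add: mod_simps mod_eq_0_iff_dvd)
      hence "int p dvd y \<or> int p dvd a"
        using p by (metis prime_dvd_mult_iff prime_dvd_power prime_nat_int_transfer)
      thus False using y a car by (auto dest: zdvd_imp_le)
    qed
    have xb: "0 \<le> x" "x < int p" using p1 x by simp_all
    have "[(int p - y) ^ 3 = (- y) ^ 3] (mod int p)"
      by (intro cong_pow) (simp add: cong_iff_dvd_diff)
    hence "[(int p - y) ^ 3 * a = (- y) ^ 3 * a] (mod int p)" by (rule cong_scalar_right)
    moreover have "(- y) ^ 3 * a = - (y ^ 3 * a)" by (simp add: power3_eq_cube)
    ultimately have "((int p - y) ^ 3 * a) mod int p = (- (y ^ 3 * a)) mod int p"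
      by (simp add: cong_def)
    also have "\<dots> = (- x) mod int p" unfolding x by (simp add: mod_simps)
    also have "\<dots> = int p - x" using xb xn0 by (simp add: zmod_zminus1_eq_if)
    finally have "int p - x = ((int p - y) ^ 3 mod int p * a) mod int p"
      by (simp add: mod_simps)
    thus ?thesis unfolding Aeq' using y by (intro image_eqI[of _ _ "int p - y"]) auto
  qed
  let ?e = "\<lambda>j::int. exp (2 * of_real pi * \<i> * of_int j / of_nat p) :: complex"
  have cnj_e: "cnj (?e j) = ?e (int p - j)" for j
  proof -
    have "?e (int p - j) = exp (2 * of_real pi * \<i> - 2 * of_real pi * \<i> * of_int j / of_nat p)"
      using p1 by (simp add: field_simps)
    also have "\<dots> = exp (- (2 * of_real pi * \<i> * of_int j / of_nat p))"
      by (simp add: exp_diff exp_minus exp_two_pi_i divide_inverse)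
    also have "\<dots> = cnj (?e j)" by (simp add: exp_cnj)
    finally show ?thesis by simp
  qed
  have "cnj (gaussian_period p A) = (\<Sum>j\<in>A. ?e (int p - j))"
    unfolding gaussian_period_def cnj_sum cnj_e ..
  also have "\<dots> = gaussian_period p A"
    unfolding gaussian_period_def
    by (rule sum.reindex_bij_witness[of _ "\<lambda>j. int p - j" "\<lambda>j. int p - j"]) (auto intro: neg)
  finally show ?thesis by (simp add: Reals_cnj_iff)
qed

end

(*
  With x_k = (h - 1)/3 - eta_k (respectively (h + 1)/3 + eta_k), the numbers x_0, x_1, x_2 are the
  roots of Shanks' cubic X^3 - h X^2 - (h + 3) X - 1. If a, b, c are their real cube roots, then
  abc = 1, and cubing s = a + b + c and t = ab + bc + ca gives s^3 = h - 3 + 3st and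
  t^3 = -h - 6 + 3st, so that (3 - st)^3 = p and s^3 = 6 + h - 3 p^(1/3).

  The minimal polynomial of the periods comes from Fourier analysis modulo p: the degree 3 moments
  of the periods are determined by numbers of solutions of a + b + c = 0 with a, b, c in prescribed
  classes. They yield an integer L = 1 (mod 3) fixing the product of the periods, and express
  the square root of the discriminant as p M with M an integer; comparing with the discriminant
  formula, 4p = L^2 + 27 M^2. As also 4p = (2h + 3)^2 + 27, uniqueness gives L = -(2h + 3)
  or L = 2h + 3, according to h modulo 3.
*)
theory Submission
  imports Defs
begin

section \<open>Cube roots of the roots of Shanks' cubic\<close>

lemma sum_cube_roots_simplest_cubic:
  fixes x y z h q :: real
  assumes "x + y + z = h" "x * y + y * z + z * x = - (h + 3)" "x * y * z = 1"
    and q: "q = h\<^sup>2 + 3 * h + 9"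
  shows "root 3 x + root 3 y + root 3 z = root 3 (6 + h - 3 * root 3 q)"
proof -
  define a b c where abc: "a = root 3 x" "b = root 3 y" "c = root 3 z"
  have cubes: "a ^ 3 = x" "b ^ 3 = y" "c ^ 3 = z"
    by (simp_all add: abc odd_real_root_pow)
  have "(a * b * c) ^ 3 = 1"
    using assms cubes by (simp add: power_mult_distrib)
  hence prod: "a * b * c = 1"
    using odd_real_root_power_cancel[of 3 "a * b * c"] by simp
  define s t where st: "s = a + b + c" "t = a * b + b * c + c * a"
  have "a ^ 3 + b ^ 3 + c ^ 3 = s ^ 3 - 3 * s * t + 3 * (a * b * c)"
    unfolding st by (simp add: power2_eq_square power3_eq_cube algebra_simps)
  hence s3: "s ^ 3 = h - 3 + 3 * (s * t)"
    using assms cubes prod by simp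
  \<comment> \<open>The preceding identity again, for \<open>a * b\<close>, \<open>b * c\<close>,
    \<open>c * a\<close>: their sum is \<open>t\<close>, their pairwise products sum to
    \<open>a * b * c * s\<close>, and their product is the square of
    \<open>a * b * c\<close>.\<close>
  have "(a * b) ^ 3 + (b * c) ^ 3 + (c * a) ^ 3
      = t ^ 3 - 3 * s * t * (a * b * c) + 3 * (a * b * c)\<^sup>2"
    unfolding st by (simp add: power2_eq_square power3_eq_cube algebra_simps)
  hence t3: "t ^ 3 = - h - 6 + 3 * (s * t)"
    using assms cubes prod by (simp add: power_mult_distrib)
  \<comment> \<open>The cube of \<open>s * t\<close> is the product of the two expressions
    \<open>s3\<close> and \<open>t3\<close>. Both are linear in \<open>s * t\<close>, and after
    substitution every term containing \<open>s * t\<close> cancels.\<close>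
  have "(3 - s * t) ^ 3 = 27 - 27 * (s * t) + 9 * (s * t)\<^sup>2 - s ^ 3 * t ^ 3"
    by (simp add: power2_eq_square power3_eq_cube algebra_simps)
  also have "\<dots> = q"
    unfolding s3 t3 q by (simp add: power2_eq_square algebra_simps)
  finally have "root 3 q = 3 - s * t"
    using odd_real_root_power_cancel[of 3 "3 - s * t"] by simp
  hence "s ^ 3 = 6 + h - 3 * root 3 q"
    using s3 by simp
  hence "root 3 (6 + h - 3 * root 3 q) = s"
    using odd_real_root_power_cancel[of 3 s] by simp
  thus ?thesis
    by (simp add: st abc)
qed

section \<open>Uniqueness of the representation of four times a prime\<close>

text \<open>Composing the two representations gives one of \<open>16 * (int p)\<^sup>2\<close> by
  the same form. For a suitable sign of \<open>M\<close> its second coordinate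
  \<open>L - A * M\<close> is divisible by \<open>p\<close>, and size then forces it to
  vanish.\<close>

lemma four_prime_repr_unique:
  fixes p :: nat and A L M :: int
  assumes p: "prime p"
    and A: "4 * int p = A\<^sup>2 + 27" and L: "4 * int p = L\<^sup>2 + 27 * M\<^sup>2"
  shows "\<bar>L\<bar> = \<bar>A\<bar>"
proof -
  have p0: "int p > 0"
    using p prime_gt_0_nat by simp
  \<comment> \<open>\<open>M\<close> is generalized here because the sign for which the divisibility
    holds is not known in advance.\<close>
  have *: "\<bar>L\<bar> = \<bar>A\<bar>" if dvd: "int p dvd L - A * M" and L: "4 * int p = L\<^sup>2 + 27 * M\<^sup>2" for M
  proof -
    have "(L * A + 27 * M)\<^sup>2 + 27 * (L - A * M)\<^sup>2 = (L\<^sup>2 + 27 * M\<^sup>2) * (A\<^sup>2 + 27)"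
      by (simp add: power2_eq_square algebra_simps)
    also have "\<dots> = 16 * (int p)\<^sup>2"
      unfolding A[symmetric] L[symmetric] by (simp add: power2_eq_square)
    finally have "(L * A + 27 * M)\<^sup>2 + 27 * (L - A * M)\<^sup>2 = 16 * (int p)\<^sup>2" .
    hence "27 * (L - A * M)\<^sup>2 \<le> 16 * (int p)\<^sup>2"
      by (smt (verit) zero_le_power2)
    \<comment> \<open>As 27 > 16, this multiple of \<open>p\<close> is smaller than \<open>p\<close>
      in absolute value, hence zero.\<close>
    hence "(L - A * M)\<^sup>2 < (int p)\<^sup>2"
      using p0 by (smt (verit) zero_less_power)
    hence "\<bar>L - A * M\<bar> < int p"
      by (metis abs_of_nat power2_less_imp_less power2_abs abs_ge_zero of_nat_0_le_iff)
    hence LAM: "L = A * M"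
      using dvd zdvd_imp_le[of "int p" "\<bar>L - A * M\<bar>"] by force
    have "4 * int p = (A\<^sup>2 + 27) * M\<^sup>2"
      unfolding L LAM by (simp add: power_mult_distrib algebra_simps)
    hence "(4 * int p) * M\<^sup>2 = 4 * int p"
      unfolding A by simp
    hence "M\<^sup>2 = 1"
      using p0 by simp
    hence "L\<^sup>2 = A\<^sup>2"
      by (simp add: LAM power_mult_distrib)
    thus ?thesis
      by (simp add: power2_eq_iff abs_eq_iff)
  qed
  have "(L - A * M) * (L - A * (- M)) = int p * (4 - 4 * M\<^sup>2)"
  proof -
    have "(L - A * M) * (L - A * (- M)) = L\<^sup>2 - A\<^sup>2 * M\<^sup>2"
      by (simp add: power2_eq_square algebra_simps)
    moreover have "L\<^sup>2 = 4 * int p - 27 * M\<^sup>2" "A\<^sup>2 = 4 * int p - 27"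
      using A L by simp_all
    ultimately show ?thesis
      by (simp add: algebra_simps)
  qed
  hence "int p dvd (L - A * M) * (L - A * (- M))"
    by simp
  hence "int p dvd L - A * M \<or> int p dvd L - A * (- M)"
    using p by (simp add: prime_dvd_mult_iff)
  thus ?thesis
    using *[of M] *[of "- M"] L by auto
qed

section \<open>The additive character\<close>

definition add_char :: "nat \<Rightarrow> int \<Rightarrow> complex" where
  "add_char p j = exp (2 * of_real pi * \<i> * of_int j / of_nat p)"

lemma gaussian_period_add_char: "gaussian_period p A = (\<Sum>j\<in>A. add_char p j)"
  by (simp add: gaussian_period_def add_char_def)

lemma add_char_0 [simp]: "add_char p 0 = 1"
  by (simp add: add_char_def)

lemma add_char_add: "add_char p (a + b) = add_char p a * add_char p b"
  by (simp add: add_char_def flip: exp_add) (simp add: add_divide_distrib distrib_left)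

lemma add_char_of_nat_mult: "add_char p (int t * m) = add_char p m ^ t"
  by (induction t) (simp_all add: distrib_right add_char_add)

lemma add_char_eq_1_iff:
  assumes "p > 0"
  shows "add_char p j = 1 \<longleftrightarrow> int p dvd j"
proof -
  have "add_char p j = 1 \<longleftrightarrow> (\<exists>n::int. 2 * pi * of_int j / of_nat p = of_int (2 * n) * pi)"
    by (auto simp: add_char_def exp_eq_1 Re_divide_of_nat Im_divide_of_nat)
  also have "\<dots> \<longleftrightarrow> (\<exists>n::int. (of_int j :: real) = of_int (int p * n))"
    using assms by (intro ex_cong1) (auto simp: field_simps)
  also have "\<dots> \<longleftrightarrow> int p dvd j"
    by (simp only: of_int_eq_iff dvd_def)
  finally show ?thesis .
qed

lemma add_char_mod:
  assumes "p > 0"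
  shows "add_char p (j mod int p) = add_char p j"
proof -
  have "add_char p j = add_char p (int p * (j div int p)) * add_char p (j mod int p)"
    by (simp flip: add_char_add)
  thus ?thesis
    using assms add_char_eq_1_iff[of p "int p * (j div int p)"] by simp
qed

text \<open>Orthogonality: a geometric sum of length \<open>p\<close> whose ratio
  \<open>add_char p m\<close> is a \<open>p\<close>-th root of unity.\<close>

lemma sum_add_char:
  assumes "p > 0"
  shows "(\<Sum>t\<in>{0..<int p}. add_char p (t * m)) = (if int p dvd m then of_nat p else 0)"
proof -
  have "(\<Sum>t\<in>{0..<int p}. add_char p (t * m)) = (\<Sum>t<p. add_char p m ^ t)"
    by (rule sum.reindex_bij_witness[of _ int nat]) (auto simp flip: add_char_of_nat_mult)
  also have "\<dots> = (if int p dvd m then of_nat p else 0)"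
  proof (cases "int p dvd m")
    case True
    hence "add_char p m = 1" using assms by (simp add: add_char_eq_1_iff)
    thus ?thesis using True by simp
  next
    case False
    moreover have "add_char p m ^ p = 1"
      using assms by (simp add: add_char_eq_1_iff flip: add_char_of_nat_mult)
    ultimately show ?thesis
      using assms by (simp add: sum_gp_strict add_char_eq_1_iff)
  qed
  finally show ?thesis .
qed

text \<open>Swapping the sums and applying orthogonality turns a moment into a count of solutions of
  a congruence; below, \<open>f\<close> adds up two or three residues.\<close>

lemma sum_sum_add_char:
  assumes "p > 0" "finite S"
  shows "(\<Sum>t\<in>{0..<int p}. \<Sum>s\<in>S. add_char p (t * f s))
       = of_nat p * of_nat (card {s\<in>S. int p dvd f s})"
  using assms
  by (subst sum.swap) (simp add: sum_add_char sum.If_cases Int_def)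

section \<open>Moments of the cubic periods\<close>

text \<open>The cosets seen as the fibres of a homomorphism from the nonzero residues to the
  integers modulo 3. Nonemptiness of \<open>C 1\<close> makes it surjective.\<close>

locale cubic_classes =
  fixes p :: nat and C :: "nat \<Rightarrow> int set"
  assumes prime: "prime p"
    and union: "(\<Union>i<3. C i) = {1..<int p}"
    and disj: "\<And>i j x. i < 3 \<Longrightarrow> j < 3 \<Longrightarrow> x \<in> C i \<Longrightarrow> x \<in> C j \<Longrightarrow> i = j"
    and mult: "\<And>i j x y. i < 3 \<Longrightarrow> j < 3 \<Longrightarrow> x \<in> C i \<Longrightarrow> y \<in> C j
                 \<Longrightarrow> x * y mod int p \<in> C ((i + j) mod 3)"
    and nonempty: "C 1 \<noteq> {}"
begin

section \<open>Sizes of the classes and multiplication between them\<close>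

lemma p_gt_1: "int p > 1"
  using prime prime_gt_1_nat by simp

lemma classD:
  assumes "i < 3" "x \<in> C i"
  shows "0 < x" "x < int p" "\<not> int p dvd x"
proof -
  have "x \<in> (\<Union>i<3. C i)"
    using assms by blast
  thus "0 < x" "x < int p"
    by (simp_all add: union)
  thus "\<not> int p dvd x"
    using zdvd_imp_le[of "int p" x] by auto
qed

lemma finite_class: "i < 3 \<Longrightarrow> finite (C i)"
  by (rule finite_subset[of _ "{1..<int p}"]) (use union in auto)

lemma inj_on_mult_mod:
  assumes "i < 3" "j < 3" "t \<in> C j"
  shows "inj_on (\<lambda>a. t * a mod int p) (C i)"
proof (rule inj_onI)
  fix a b assume ab: "a \<in> C i" "b \<in> C i" "t * a mod int p = t * b mod int p"
  hence "int p dvd t * (a - b)"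
    by (simp add: mod_eq_dvd_iff right_diff_distrib)
  hence "int p dvd a - b"
    using assms classD prime by (simp add: prime_dvd_mult_iff)
  thus "a = b"
    using ab assms classD[of i a] classD[of i b]
    by (metis mod_eq_dvd_iff mod_pos_pos_trivial less_imp_le)
qed

lemma image_mult_mod_subset:
  assumes "i < 3" "j < 3" "t \<in> C j"
  shows "(\<lambda>a. t * a mod int p) ` C i \<subseteq> C ((i + j) mod 3)"
  using mult[OF assms(2) assms(1) assms(3)] by (auto simp: add.commute)

definition n :: nat where "n = card (C 0)"

text \<open>Multiplication by an element of \<open>C 1\<close> injects each class into the next;
  going once around the cycle of three classes turns the inequalities into equalities.\<close>

lemma card_class:
  assumes "i < 3"
  shows "card (C i) = n"
proof -
  obtain t where t: "t \<in> C 1" using nonempty by blast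
  have "card (C i) \<le> card (C ((i + 1) mod 3))" if "i < 3" for i
    using that t
    by (intro card_inj_on_le[OF inj_on_mult_mod[of _ 1 t]] image_mult_mod_subset finite_class) auto
  from this[of 0] this[of 1] this[of 2] have "card (C 1) = card (C 0)" "card (C 2) = card (C 0)"
    by (simp_all add: numeral_2_eq_2)
  thus ?thesis using assms by (auto simp: n_def less_Suc_eq numeral_eq_Suc)
qed

lemma bij_betw_mult_mod:
  assumes "i < 3" "j < 3" "t \<in> C j"
  shows "bij_betw (\<lambda>a. t * a mod int p) (C i) (C ((i + j) mod 3))"
  unfolding bij_betw_def
proof
  show "(\<lambda>a. t * a mod int p) ` C i = C ((i + j) mod 3)"
    using assms
    by (intro card_subset_eq finite_class image_mult_mod_subset)
       (simp_all add: card_image inj_on_mult_mod card_class)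
qed (use assms inj_on_mult_mod in auto)

lemma sum_residues:
  fixes F :: "int \<Rightarrow> complex"
  shows "(\<Sum>t\<in>{0..<int p}. F t) = F 0 + (\<Sum>j<3. \<Sum>t\<in>C j. F t)"
proof -
  have "{0..<int p} = insert 0 (\<Union>j<3. C j)"
    using p_gt_1 by (auto simp: union)
  also have "sum F \<dots> = F 0 + sum F (\<Union>j<3. C j)"
    by (subst sum.insert) (auto simp: union)
  also have "sum F (\<Union>j<3. C j) = (\<Sum>j<3. \<Sum>t\<in>C j. F t)"
    by (rule sum.UNION_disjoint) (use disj finite_class in auto)
  finally show ?thesis .
qed

lemma three_n: "3 * n + 1 = p"
proof -
  have "of_nat p = (1 + of_nat (3 * n) :: complex)"
    using sum_residues[of "\<lambda>_. 1"]
    by (simp add: card_class algebra_simps)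
  hence "(of_nat p :: complex) = of_nat (3 * n + 1)" by simp
  thus ?thesis by (simp only: of_nat_eq_iff)
qed

text \<open>Since 1 is idempotent, its index \<open>i\<close> satisfies 2i = i modulo 3.\<close>

lemma one_in_class: "1 \<in> C 0"
proof -
  obtain i where i: "i < 3" "1 \<in> C i"
    using union p_gt_1 by (metis UN_E atLeastLessThan_iff lessThan_iff order_refl)
  hence "1 \<in> C ((i + i) mod 3)"
    using mult[of i i 1 1] p_gt_1 by simp
  hence "i = (i + i) mod 3"
    using i disj by simp
  hence "i = 0" using i(1) by presburger
  thus ?thesis using i by simp
qed

lemma n_pos: "n > 0"
  using one_in_class finite_class[of 0] by (auto simp: n_def card_gt_0_iff)

text \<open>Since -1 squares to 1, its index \<open>i\<close> satisfies 2i = 0 modulo 3. Hence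
  \<open>C 0\<close> is closed under negation modulo \<open>p\<close>.\<close>

lemma minus_one_in_class: "int p - 1 \<in> C 0"
proof -
  have "int p - 1 \<in> {1..<int p}" using p_gt_1 by simp
  then obtain i where i: "i < 3" "int p - 1 \<in> C i"
    using union by (metis UN_E lessThan_iff)
  have "(int p - 1) * (int p - 1) mod int p = 1 mod int p"
    by (simp add: mod_eq_dvd_iff algebra_simps)
  hence "1 \<in> C ((i + i) mod 3)"
    using mult[OF i(1) i(1) i(2) i(2)] p_gt_1 by simp
  hence "(i + i) mod 3 = 0"
    using disj[OF _ _ _ one_in_class] by simp
  hence "i = 0" using i(1) by presburger
  thus ?thesis using i by simp
qed

section \<open>Periods as Fourier coefficients, their sum and sum of squares\<close>

abbreviation period :: "nat \<Rightarrow> complex" where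
  "period i \<equiv> gaussian_period p (C i)"

text \<open>The Fourier transform modulo \<open>p\<close> of the indicator function of
  \<open>C i\<close>, at frequency \<open>t\<close>.\<close>

definition twist :: "nat \<Rightarrow> int \<Rightarrow> complex" where
  "twist i t = (\<Sum>a\<in>C i. add_char p (t * a))"

lemma twist_0: "i < 3 \<Longrightarrow> twist i 0 = of_nat n"
  by (simp add: twist_def card_class)

lemma twist_class:
  assumes "i < 3" "j < 3" "t \<in> C j"
  shows "twist i t = period ((i + j) mod 3)"
proof -
  have "period ((i + j) mod 3) = (\<Sum>a\<in>C i. add_char p (t * a mod int p))"
    unfolding gaussian_period_add_char
    by (rule sum.reindex_bij_betw[OF bij_betw_mult_mod[OF assms], symmetric])
  thus ?thesis
    using p_gt_1 by (simp add: twist_def add_char_mod)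
qed

lemma sum_period: "(\<Sum>i<3. period i) = -1"
proof -
  have "\<not> int p dvd 1"
    using p_gt_1 by simp
  hence "1 + (\<Sum>i<3. period i) = 0"
    using sum_residues[of "add_char p"] sum_add_char[of p 1] p_gt_1
    by (simp add: gaussian_period_add_char)
  thus ?thesis
    by (metis add.commute add_eq_0_iff)
qed

text \<open>The sum of \<open>twist 0 t ^ 2\<close> over all \<open>t\<close> is evaluated twice: by
  orthogonality as \<open>p\<close> times the number of pairs in \<open>C 0\<close> with sum 0
  modulo \<open>p\<close>, and by sorting \<open>t\<close> into 0 and the three classes. Negation
  preserves \<open>C 0\<close>, so there are \<open>n\<close> such pairs.\<close>

lemma sum_period_square: "(\<Sum>r<3. period r ^ 2) = of_nat p - of_nat n"
proof -
  let ?S = "C 0 \<times> C 0"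
  have twist_sq: "twist 0 t ^ 2 = (\<Sum>s\<in>?S. add_char p (t * (fst s + snd s)))" for t
    unfolding twist_def power2_eq_square sum_product sum.cartesian_product
    by (simp add: distrib_left add_char_add case_prod_beta)
  have "{s \<in> ?S. int p dvd fst s + snd s} = (\<lambda>a. (a, int p - a)) ` C 0"
  proof (intro equalityI subsetI)
    fix s assume "s \<in> {s \<in> ?S. int p dvd fst s + snd s}"
    then obtain a b where s: "s = (a, b)" "a \<in> C 0" "b \<in> C 0" "int p dvd a + b" by force
    have "0 < a + b" "a + b < 2 * int p"
      using s classD[of 0 a] classD[of 0 b] by auto
    moreover obtain k where k: "a + b = int p * k" using s by blast
    ultimately have bounds: "0 < int p * k" "int p * k < int p * 2"
      unfolding k[symmetric] by simp_all
    have "0 < k"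
      using bounds(1) by (rule zero_less_mult_pos) (use p_gt_1 in simp)
    moreover have "k < 2"
      using bounds(2) by (rule mult_left_less_imp_less) simp
    ultimately have "k = 1"
      by simp
    thus "s \<in> (\<lambda>a. (a, int p - a)) ` C 0" using k s by force
  next
    fix s assume "s \<in> (\<lambda>a. (a, int p - a)) ` C 0"
    then obtain a where a: "a \<in> C 0" "s = (a, int p - a)" by blast
    \<comment> \<open>The negative of \<open>a\<close> is its product with -1, so it stays in
      \<open>C 0\<close>.\<close>
    have "(int p - 1) * a mod int p = (int p - a) mod int p"
      by (simp add: mod_eq_dvd_iff algebra_simps)
    also have "\<dots> = int p - a"
      using classD[of 0 a] a by (intro mod_pos_pos_trivial) simp_all
    finally have "int p - a \<in> C 0"
      using mult[of 0 0 "int p - 1" a] a minus_one_in_class by simp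
    thus "s \<in> {s \<in> ?S. int p dvd fst s + snd s}" using a by simp
  qed
  hence "card {s \<in> ?S. int p dvd fst s + snd s} = n"
    by (simp add: card_image inj_on_def n_def)
  hence "of_nat p * of_nat n = (\<Sum>t\<in>{0..<int p}. twist 0 t ^ 2)"
    using p_gt_1 by (simp add: twist_sq sum_sum_add_char finite_class)
  also have "\<dots> = of_nat n ^ 2 + (\<Sum>r<3. \<Sum>t\<in>C r. period r ^ 2)"
    by (simp add: sum_residues twist_0 twist_class)
  also have "(\<Sum>r<3. \<Sum>t\<in>C r. period r ^ 2) = of_nat n * (\<Sum>r<3. period r ^ 2)"
    by (simp add: card_class sum_distrib_left)
  finally have "of_nat n * (of_nat p - of_nat n - (\<Sum>r<3. period r ^ 2)) = 0"
    by (simp add: algebra_simps power2_eq_square)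
  thus ?thesis using n_pos by simp
qed

section \<open>Cyclotomic numbers and third moments\<close>

text \<open>The cyclotomic numbers of order 3. Because -1 lies in \<open>C 0\<close>, the symmetric
  equation 1 + b + c = 0 has as many solutions as the usual 1 + b = c.\<close>

definition N :: "nat \<Rightarrow> nat \<Rightarrow> nat" where
  "N j k = card {s \<in> C j \<times> C k. int p dvd 1 + fst s + snd s}"

text \<open>Multiplication by \<open>a\<close> permutes \<open>C j\<close> and \<open>C k\<close>
  and carries solutions of 1 + b + c = 0 to solutions of a + b + c = 0.\<close>

lemma card_shifted_solutions:
  assumes jk: "j < 3" "k < 3" and a: "a \<in> C 0"
  shows "card {s \<in> C j \<times> C k. int p dvd a + fst s + snd s} = N j k"
  unfolding N_def
proof (rule bij_betw_same_card[symmetric])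
  let ?m = "\<lambda>b. a * b mod int p"
  have bij: "bij_betw (map_prod ?m ?m) (C j \<times> C k) (C j \<times> C k)"
    using bij_betw_mult_mod[OF jk(1) _ a] bij_betw_mult_mod[OF jk(2) _ a] jk
    by (intro bij_betw_map_prod) simp_all
  have dvd: "int p dvd a + fst (map_prod ?m ?m s) + snd (map_prod ?m ?m s)
      \<longleftrightarrow> int p dvd 1 + fst s + snd s" for s
  proof -
    have "[a + ?m (fst s) + ?m (snd s) = a * (1 + fst s + snd s)] (mod int p)"
      unfolding distrib_left by (intro cong_add) (simp_all add: cong_def)
    hence "int p dvd a + ?m (fst s) + ?m (snd s) \<longleftrightarrow> int p dvd a * (1 + fst s + snd s)"
      by (rule cong_dvd_iff)
    thus ?thesis
      using prime classD[OF _ a] by (simp add: prime_dvd_mult_iff)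
  qed
  show "bij_betw (map_prod ?m ?m) {s \<in> C j \<times> C k. int p dvd 1 + fst s + snd s}
      {s \<in> C j \<times> C k. int p dvd a + fst s + snd s}"
    using bij dvd by (rule bij_betw_Collect)
qed

text \<open>The double evaluation used for the squares, now for the product of three twists. Each
  first coordinate in \<open>C 0\<close> contributes \<open>N j k\<close> solutions, and the
  frequency 0 contributes the cube of \<open>n\<close>; a common factor \<open>n\<close> is then
  cancelled.\<close>

lemma sum_period_triple:
  assumes jk: "j < 3" "k < 3"
  shows "(\<Sum>r<3. period r * period ((j + r) mod 3) * period ((k + r) mod 3))
       = of_nat p * of_nat (N j k) - of_nat n ^ 2"
proof -
  let ?S = "C 0 \<times> C j \<times> C k"
  let ?f = "\<lambda>s::int \<times> int \<times> int. fst s + fst (snd s) + snd (snd s)"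
  let ?P = "\<Sum>r<3. period r * period ((j + r) mod 3) * period ((k + r) mod 3)"
  have twist3: "twist 0 t * twist j t * twist k t = (\<Sum>s\<in>?S. add_char p (t * ?f s))" for t
    by (simp add: twist_def sum.cartesian_product' distrib_left add_char_add mult.assoc
        flip: sum_distrib_left sum_distrib_right)
  have "{s \<in> ?S. int p dvd ?f s}
      = (SIGMA a:C 0. {s \<in> C j \<times> C k. int p dvd a + fst s + snd s})"
    by auto
  hence "card {s \<in> ?S. int p dvd ?f s} = n * N j k"
    using jk by (simp add: card_SigmaI finite_class card_shifted_solutions n_def)
  hence "of_nat p * of_nat (n * N j k) = (\<Sum>t\<in>{0..<int p}. twist 0 t * twist j t * twist k t)"
    using p_gt_1 jk by (simp add: twist3 sum_sum_add_char finite_class del: of_nat_mult)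
  also have "\<dots> = of_nat n ^ 3 + (\<Sum>r<3. \<Sum>t\<in>C r.
      period r * period ((j + r) mod 3) * period ((k + r) mod 3))"
    using jk by (simp add: sum_residues twist_0 twist_class power3_eq_cube)
  also have "\<dots> = of_nat n ^ 3 + of_nat n * ?P"
    by (simp add: card_class sum_distrib_left)
  finally have "of_nat n * (of_nat p * of_nat (N j k) - of_nat n ^ 2 - ?P) = 0"
    by (simp add: algebra_simps power2_eq_square power3_eq_cube)
  thus ?thesis using n_pos by simp
qed

section \<open>Elementary symmetric functions of the periods\<close>

lemma period_polynomial:
  fixes \<eta> :: "nat \<Rightarrow> real" and A :: int
  assumes \<eta>: "\<forall>i<3. period i = of_real (\<eta> i)"
    and A: "4 * int p = A\<^sup>2 + 27" "[A = 1] (mod 3)"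
  shows "\<eta> 0 + \<eta> 1 + \<eta> 2 = -1"
    and "\<eta> 0 * \<eta> 1 + \<eta> 1 * \<eta> 2 + \<eta> 2 * \<eta> 0 = (1 - real p) / 3"
    and "\<eta> 0 * \<eta> 1 * \<eta> 2 = (real p * (of_int A + 3) - 1) / 27"
proof -
  define x y z where xyz: "x = \<eta> 0" "y = \<eta> 1" "z = \<eta> 2"
  have sum3: "(\<Sum>r<3. f r) = f 0 + f 1 + f (2::nat)" for f :: "nat \<Rightarrow> complex"
    by (simp add: eval_nat_numeral)
  have per: "period 0 = of_real x" "period 1 = of_real y" "period (Suc 0) = of_real y"
    "period 2 = of_real z" "period (Suc (Suc 0)) = of_real z"
    using \<eta> by (simp_all add: xyz numeral_2_eq_2)
  have n: "real n = (real p - 1) / 3"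
    using three_n by simp

  have "of_real (x + y + z) = (of_real (- 1) :: complex)"
    using sum_period by (simp add: sum3 per)
  hence e1: "x + y + z = -1"
    by (simp only: of_real_eq_iff)
  have "of_real (x\<^sup>2 + y\<^sup>2 + z\<^sup>2) = (of_real (real p - real n) :: complex)"
    using sum_period_square by (simp add: sum3 per)
  hence p2: "x\<^sup>2 + y\<^sup>2 + z\<^sup>2 = real p - real n"
    by (simp only: of_real_eq_iff)
  have "of_real (x ^ 3 + y ^ 3 + z ^ 3) = (of_real (real p * real (N 0 0) - (real n)\<^sup>2) :: complex)"
    using sum_period_triple[of 0 0] by (simp add: sum3 per power3_eq_cube)
  hence p3: "x ^ 3 + y ^ 3 + z ^ 3 = real p * real (N 0 0) - (real n)\<^sup>2"
    by (simp only: of_real_eq_iff)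
  \<comment> \<open>The two cyclic sums \<open>q1\<close> and \<open>q2\<close> differ by (x - y)(y
    - z)(x - z), a square root of the discriminant; in the difference the terms with
    \<open>n\<close> cancel, leaving \<open>p\<close> times an integer.\<close>
  have "of_real (x * x * y + y * y * z + z * z * x)
      = (of_real (real p * real (N 0 1) - (real n)\<^sup>2) :: complex)"
    using sum_period_triple[of 0 1] by (simp add: sum3 per)
  hence q1: "x * x * y + y * y * z + z * z * x = real p * real (N 0 1) - (real n)\<^sup>2"
    by (simp only: of_real_eq_iff)
  have "of_real (x * y * y + y * z * z + z * x * x)
      = (of_real (real p * real (N 1 1) - (real n)\<^sup>2) :: complex)"
    using sum_period_triple[of 1 1] by (simp add: sum3 per)
  hence q2: "x * y * y + y * z * z + z * x * x = real p * real (N 1 1) - (real n)\<^sup>2"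
    by (simp only: of_real_eq_iff)

  \<comment> \<open>\<open>L\<close> is the integer for which Newton's identity for
    \<open>p3\<close> yields \<open>e3\<close> in the form of the third claim.\<close>
  define L M where LM: "L = 9 * int (N 0 0) - int p + 8" "M = int (N 0 1) - int (N 1 1)"
  define e2 e3 where e: "e2 = x * y + y * z + z * x" "e3 = x * y * z"
  have "x\<^sup>2 + y\<^sup>2 + z\<^sup>2 = (x + y + z)\<^sup>2 - 2 * e2"
    by (simp add: e power2_eq_square algebra_simps)
  hence e2: "e2 = (1 - real p) / 3"
    unfolding e1 p2 n by (simp add: field_simps)
  have "x ^ 3 + y ^ 3 + z ^ 3 = (x + y + z) ^ 3 - 3 * (x + y + z) * e2 + 3 * e3"
    by (simp add: e power3_eq_cube algebra_simps)
  hence e3: "e3 = (real p * (of_int L + 3) - 1) / 27"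
    unfolding p3 e1 e2 n LM by (simp add: power2_eq_square field_simps)

  \<comment> \<open>The discriminant of a cubic in terms of its elementary symmetric functions.
    Comparing it with the square of \<open>p * M\<close> gives the representation of
    \<open>4 * p\<close>.\<close>
  have "((x * x * y + y * y * z + z * z * x) - (x * y * y + y * z * z + z * x * x))\<^sup>2
      = (x + y + z)\<^sup>2 * e2\<^sup>2 - 4 * e2 ^ 3 - 4 * (x + y + z) ^ 3 * e3
        + 18 * (x + y + z) * e2 * e3 - 27 * e3\<^sup>2"
    by (simp add: e power2_eq_square power3_eq_cube algebra_simps)
  hence "(real p * of_int M)\<^sup>2 = e2\<^sup>2 - 4 * e2 ^ 3 + 4 * e3 - 18 * e2 * e3 - 27 * e3\<^sup>2"
    by (simp add: q1 q2 e1 LM right_diff_distrib)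
  also have "\<dots> = (real p)\<^sup>2 * (4 * real p - of_int L ^ 2) / 27"
    unfolding e2 e3 by (simp add: power2_eq_square power3_eq_cube field_simps)
  finally have "(real p)\<^sup>2 * (27 * of_int M ^ 2) = (real p)\<^sup>2 * (4 * real p - of_int L ^ 2)"
    by (simp add: power_mult_distrib mult.commute)
  hence "27 * of_int M ^ 2 = 4 * real p - of_int L ^ 2"
    using p_gt_1 by simp
  hence "real_of_int (4 * int p) = of_int (L\<^sup>2 + 27 * M\<^sup>2)"
    by simp
  hence "4 * int p = L\<^sup>2 + 27 * M\<^sup>2"
    by (simp only: of_int_eq_iff)
  hence "\<bar>L\<bar> = \<bar>A\<bar>"
    using four_prime_repr_unique prime A by blast
  \<comment> \<open>The residue modulo 3 settles the sign: \<open>L = - A\<close> would make 1 and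
    -1 congruent modulo 3.\<close>
  moreover have "L = 3 * (3 * int (N 0 0) - int n + 2) + 1"
    using three_n by (simp add: LM)
  hence "L mod 3 = 1"
    by presburger
  moreover have "A mod 3 = 1"
    using A by (simp add: cong_def)
  ultimately have "L = A"
    by presburger
  with e1 e2 e3 show "\<eta> 0 + \<eta> 1 + \<eta> 2 = -1"
    "\<eta> 0 * \<eta> 1 + \<eta> 1 * \<eta> 2 + \<eta> 2 * \<eta> 0 = (1 - real p) / 3"
    "\<eta> 0 * \<eta> 1 * \<eta> 2 = (real p * (of_int A + 3) - 1) / 27"
    by (simp_all add: e xyz)
qed

end

section \<open>Cosets of the cubes\<close>

text \<open>In a group of order 3 cancellation determines the whole table, so any numbering with the
  identity at 0 is an isomorphism with the integers modulo 3. This is why the order of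
  \<open>C 1\<close> and \<open>C 2\<close> is immaterial.\<close>

lemma (in group) mult_of_three_elements:
  assumes c: "bij_betw c {0, 1, 2::nat} (carrier G)" and one: "c 0 = \<one>"
    and ij: "i < 3" "j < 3"
  shows "c i \<otimes> c j = c ((i + j) mod 3)"
proof -
  have carr: "carrier G = {\<one>, c 1, c 2}"
    using c one by (simp add: bij_betw_def)
  have neq: "c 1 \<noteq> \<one>" "c 2 \<noteq> \<one>" "c 1 \<noteq> c 2"
    using c unfolding bij_betw_def one[symmetric] by (auto simp: inj_on_def)
  have in_carr: "c 1 \<in> carrier G" "c 2 \<in> carrier G"
    by (simp_all add: carr)
  have "c 1 \<otimes> c 2 \<noteq> c 1" "c 1 \<otimes> c 2 \<noteq> c 2" "c 2 \<otimes> c 1 \<noteq> c 1" "c 2 \<otimes> c 1 \<noteq> c 2"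
    using in_carr neq by simp_all
  moreover have "c 1 \<otimes> c 2 \<in> carrier G" "c 2 \<otimes> c 1 \<in> carrier G"
    using in_carr by simp_all
  ultimately have 12: "c 1 \<otimes> c 2 = \<one>" "c 2 \<otimes> c 1 = \<one>"
    unfolding carr by auto
  have "c 1 \<otimes> c 1 \<noteq> c 1 \<otimes> c 2" "c 2 \<otimes> c 2 \<noteq> c 2 \<otimes> c 1" "c 1 \<otimes> c 1 \<noteq> c 1" "c 2 \<otimes> c 2 \<noteq> c 2"
    using in_carr neq by simp_all
  moreover have "c 1 \<otimes> c 1 \<in> carrier G" "c 2 \<otimes> c 2 \<in> carrier G"
    using in_carr by simp_all
  ultimately have 11: "c 1 \<otimes> c 1 = c 2" "c 2 \<otimes> c 2 = c 1"
    unfolding 12 carr by auto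
  have "i = 0 \<or> i = 1 \<or> i = 2" "j = 0 \<or> j = 1 \<or> j = 2"
    using ij by auto
  thus ?thesis
    using 11 12 in_carr one by (elim disjE) (simp_all add: numeral_2_eq_2)
qed

text \<open>In an abelian group the power map is an endomorphism.\<close>

lemma (in comm_group) subgroup_image_pow:
  "subgroup ((\<lambda>x. x [^] (n::nat)) ` carrier G) G"
proof (rule subgroupI)
  fix a b
  assume "a \<in> (\<lambda>x. x [^] n) ` carrier G" "b \<in> (\<lambda>x. x [^] n) ` carrier G"
  then obtain x y where xy: "x \<in> carrier G" "y \<in> carrier G" "a = x [^] n" "b = y [^] n"
    by blast
  thus "a \<otimes> b \<in> (\<lambda>x. x [^] n) ` carrier G"
    by (intro image_eqI[of _ _ "x \<otimes> y"]) (simp_all add: nat_pow_distrib)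
  show "inv a \<in> (\<lambda>x. x [^] n) ` carrier G"
    using xy by (intro image_eqI[of _ _ "inv x"]) (simp_all add: nat_pow_inv)
qed auto

lemma cubic_cosets_imp_cubic_classes:
  assumes p: "prime p" and C: "cubic_cosets p C"
  shows "cubic_classes p C"
proof -
  interpret R: residues_prime p "residue_ring (int p)"
    using p by unfold_locales auto
  let ?G = "mult_residues p"
  let ?H = "cubes p"
  interpret G: comm_group ?G
    unfolding mult_residues_def by (rule R.units_comm_group)
  have p1: "int p > 1"
    using prime_gt_1_nat[OF p] by simp
  have car: "carrier ?G = {1..<int p}"
    using p1 by (auto simp: mult_residues_def units_of_carrier R.res_prime_units_eq of_nat_diff)
  have mul: "x \<otimes>\<^bsub>?G\<^esub> y = x * y mod int p" for x y
    by (simp add: mult_residues_def units_of_mult R.res_mult_eq)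
  have H: "subgroup ?H ?G"
    unfolding cubes_def by (rule G.subgroup_image_pow)
  interpret N: normal ?H ?G
    using H by (rule G.subgroup_imp_normal)
  interpret F: group "?G Mod ?H"
    by (rule N.factorgroup_is_group)
  have C0: "C 0 = ?H" and bij: "bij_betw C {0, 1, 2} (rcosets\<^bsub>?G\<^esub> ?H)"
    using C by (auto simp: cubic_cosets_def)
  have less3: "{..<3} = {0, 1, 2::nat}"
    by auto
  have in_rcos: "C i \<in> rcosets\<^bsub>?G\<^esub> ?H" if "i < 3" for i
    using bij that less3 by (metis bij_betwE lessThan_iff)
  show ?thesis
  proof
    show "(\<Union>i<3. C i) = {1..<int p}"
      using bij G.rcosets_part_G[OF H] by (simp only: less3 bij_betw_def car)
  next
    fix i j x assume *: "i < (3::nat)" "j < (3::nat)" "x \<in> C i" "x \<in> C j"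
    hence "C i = C j"
      using G.rcos_disjoint[OF H] in_rcos by (meson disjnt_iff pairwiseD)
    moreover have "inj_on C {..<3}"
      using bij unfolding less3 by (simp add: bij_betw_def)
    ultimately show "i = j"
      using * by (simp add: inj_on_eq_iff)
  next
    fix i j x y assume *: "i < (3::nat)" "j < (3::nat)" "x \<in> C i" "y \<in> C j"
    \<comment> \<open>The factor group by the cubes has order 3 and identity \<open>C 0\<close>; its
      operation is the product of sets.\<close>
    have "C i <#>\<^bsub>?G\<^esub> C j = C ((i + j) mod 3)"
      using F.mult_of_three_elements[of C i j] bij C0 * by (simp add: FactGroup_def)
    moreover have "x \<otimes>\<^bsub>?G\<^esub> y \<in> C i <#>\<^bsub>?G\<^esub> C j"
      using * by (auto simp: set_mult_def)
    ultimately show "x * y mod int p \<in> C ((i + j) mod 3)"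
      by (simp add: mul)
  next
    show "C 1 \<noteq> {}"
      using in_rcos by (intro N.rcosets_non_empty) simp
  qed (use p in simp)
qed

section \<open>Shifted periods as roots of Shanks' cubic\<close>

theorem mainTheorem8:
  fixes h :: int and p :: nat and C :: "nat \<Rightarrow> int set" and \<eta> :: "nat \<Rightarrow> real"
  assumes "\<not> 3 dvd h"
    and "int p = h\<^sup>2 + 3 * h + 9"
    and "prime p"
    and "cubic_cosets p C"
    and "\<And>k. \<eta> k = Re (gaussian_period p (C k))"
  shows "([h = 1] (mod 3) \<longrightarrow>
            root 3 ((of_int h - 1) / 3 - \<eta> 0) + root 3 ((of_int h - 1) / 3 - \<eta> 1)
              + root 3 ((of_int h - 1) / 3 - \<eta> 2)
            = root 3 (6 + of_int h - 3 * root 3 (of_nat p)))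
       \<and> ([h = 2] (mod 3) \<longrightarrow>
            root 3 ((of_int h + 1) / 3 + \<eta> 0) + root 3 ((of_int h + 1) / 3 + \<eta> 1)
              + root 3 ((of_int h + 1) / 3 + \<eta> 2)
            = root 3 (6 + of_int h - 3 * root 3 (of_nat p)))"
proof -
  interpret cubic_classes p C
    using assms by (intro cubic_cosets_imp_cubic_classes)
  have \<eta>: "\<forall>i<3. period i = of_real (\<eta> i)"
  proof (intro allI impI)
    fix i :: nat assume "i < 3"
    hence "i \<in> {0, 1, 2}"
      by auto
    hence "C i \<in> rcosets\<^bsub>mult_residues p\<^esub> (cubes p)"
      using assms(4) unfolding cubic_cosets_def by (meson bij_betwE)
    thus "period i = of_real (\<eta> i)"
      using gaussian_period_cubic_real[OF assms(3)] by (simp add: assms(5))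
  qed
  define k :: real where "k = of_int h"
  have "real_of_int (int p) = of_int (h\<^sup>2 + 3 * h + 9)"
    using assms(2) by (simp only:)
  hence p: "real p = k\<^sup>2 + 3 * k + 9"
    by (simp add: k_def)
  \<comment> \<open>Both signs are recorded: \<open>- (2 * h + 3)\<close> is congruent to 1 modulo 3
    when \<open>h\<close> is 1, and \<open>2 * h + 3\<close> when \<open>h\<close> is 2.\<close>
  have repr: "4 * int p = (2 * h + 3)\<^sup>2 + 27" "4 * int p = (- (2 * h + 3))\<^sup>2 + 27"
    by (simp_all add: assms(2) power2_eq_square algebra_simps)
  define m m' where m_def: "m = (k - 1) / 3" and m'_def: "m' = (k + 1) / 3"
  have "root 3 (m - \<eta> 0) + root 3 (m - \<eta> 1) + root 3 (m - \<eta> 2)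
      = root 3 (6 + k - 3 * root 3 (of_nat p))" if "[h = 1] (mod 3)"
  proof (rule sum_cube_roots_simplest_cubic[OF _ _ _ p])
    have "[- (2 * h + 3) = 1] (mod 3)"
      using that unfolding cong_def by presburger
    note poly = period_polynomial[OF \<eta> repr(2) this]
    let ?x = "m - \<eta> 0" and ?y = "m - \<eta> 1" and ?z = "m - \<eta> 2"
    have "?x + ?y + ?z = 3 * m - (\<eta> 0 + \<eta> 1 + \<eta> 2)"
      by simp
    also have "\<dots> = k"
      unfolding poly m_def by (simp add: field_simps)
    finally show "?x + ?y + ?z = k" .
    have "?x * ?y + ?y * ?z + ?z * ?x = 3 * m\<^sup>2 - 2 * m * (\<eta> 0 + \<eta> 1 + \<eta> 2)
        + (\<eta> 0 * \<eta> 1 + \<eta> 1 * \<eta> 2 + \<eta> 2 * \<eta> 0)"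
      by (simp add: power2_eq_square algebra_simps)
    also have "\<dots> = - (k + 3)"
      unfolding poly p m_def by (simp add: power2_eq_square field_simps)
    finally show "?x * ?y + ?y * ?z + ?z * ?x = - (k + 3)" .
    \<comment> \<open>This product is the monic cubic with the periods as roots, evaluated at
      \<open>m\<close>.\<close>
    have "?x * ?y * ?z = m ^ 3 - m\<^sup>2 * (\<eta> 0 + \<eta> 1 + \<eta> 2)
        + m * (\<eta> 0 * \<eta> 1 + \<eta> 1 * \<eta> 2 + \<eta> 2 * \<eta> 0) - \<eta> 0 * \<eta> 1 * \<eta> 2"
      by (simp add: power2_eq_square power3_eq_cube algebra_simps)
    also have "\<dots> = 1"
      unfolding poly p m_def by (simp add: k_def[symmetric] power2_eq_square power3_eq_cube field_simps)
    finally show "?x * ?y * ?z = 1" .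
  qed
  moreover have "root 3 (m' + \<eta> 0) + root 3 (m' + \<eta> 1)
      + root 3 (m' + \<eta> 2) = root 3 (6 + k - 3 * root 3 (of_nat p))" if "[h = 2] (mod 3)"
  proof (rule sum_cube_roots_simplest_cubic[OF _ _ _ p])
    have "h mod 3 = 2"
      using that by (simp add: cong_def)
    hence "(2 * h + 3) mod 3 = 1"
      by presburger
    hence "[2 * h + 3 = 1] (mod 3)"
      by (simp add: cong_def)
    note poly = period_polynomial[OF \<eta> repr(1) this]
    let ?x = "m' + \<eta> 0" and ?y = "m' + \<eta> 1" and ?z = "m' + \<eta> 2"
    have "?x + ?y + ?z = 3 * m' + (\<eta> 0 + \<eta> 1 + \<eta> 2)"
      by simp
    also have "\<dots> = k"
      unfolding poly m'_def by (simp add: field_simps)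
    finally show "?x + ?y + ?z = k" .
    have "?x * ?y + ?y * ?z + ?z * ?x = 3 * m'\<^sup>2 + 2 * m' * (\<eta> 0 + \<eta> 1 + \<eta> 2)
        + (\<eta> 0 * \<eta> 1 + \<eta> 1 * \<eta> 2 + \<eta> 2 * \<eta> 0)"
      by (simp add: power2_eq_square algebra_simps)
    also have "\<dots> = - (k + 3)"
      unfolding poly p m'_def by (simp add: power2_eq_square field_simps)
    finally show "?x * ?y + ?y * ?z + ?z * ?x = - (k + 3)" .
    \<comment> \<open>Here the product is minus that cubic evaluated at \<open>- m'\<close>.\<close>
    have "?x * ?y * ?z = m' ^ 3 + m'\<^sup>2 * (\<eta> 0 + \<eta> 1 + \<eta> 2)
        + m' * (\<eta> 0 * \<eta> 1 + \<eta> 1 * \<eta> 2 + \<eta> 2 * \<eta> 0) + \<eta> 0 * \<eta> 1 * \<eta> 2"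
      by (simp add: power2_eq_square power3_eq_cube algebra_simps)
    also have "\<dots> = 1"
      unfolding poly p m'_def by (simp add: k_def[symmetric] power2_eq_square power3_eq_cube field_simps)
    finally show "?x * ?y * ?z = 1" .
  qed
  ultimately show ?thesis
    by (simp add: k_def m_def m'_def)
qed

end
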